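(* Let $\mathcal{D}_{\mathbf{x}}\subset\mathbb{R}^{d_x}$, let $\mathbf{Z}$ be a random variable in $\mathbb{R}^{d_z}$ with support $\mathcal{D}_{\mathbf{z}}$, and let $f:\mathcal{D}_{\mathbf{x}}\times\mathcal{D}_{\mathbf{z}}\to\mathbb{R}$ be such that for every $\mathbf{x}\in\mathcal{D}_{\mathbf{x}}$ the function $\mathbf{z}\mapsto f(\mathbf{x},\mathbf{z})$ is continuous on $\mathcal{D}_{\mathbf{z}}$ and attains its minimum there. Then the adversarially robust optimization problem over $\mathcal{D}_{\mathbf{x}}$ coincides with the value-at-risk optimization problem in the limit $\alpha\to0^+$: $$\arg\max_{\mathbf{x}\in\mathcal{D}_{\mathbf{x}}}\ \min_{\mathbf{z}\in\mathcal{D}_{\mathbf{z}}} f(\mathbf{x},\mathbf{z}) \;=\; \arg\max_{\mathbf{x}\in\mathcal{D}_{\mathbf{x}}}\ \lim_{\alpha\to0^+} V_\alpha(f(\mathbf{x},\mathbf{Z}))$$ (equality of the sets of maximizers).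
   Context: The support of $\mathbf{Z}$ is the smallest closed subset $\mathcal{D}_{\mathbf{z}}$ of $\mathbb{R}^{d_z}$ such that $P(\mathbf{Z}\in\mathcal{D}_{\mathbf{z}})=1$. For a real random variable $Y$ and $\alpha\in(0,1)$, the value-at-risk is $V_\alpha(Y) := \inf\{\omega\in\mathbb{R} : P(Y\le\omega)\ge\alpha\}$. For fixed $\mathbf{x}$, $f(\mathbf{x},\mathbf{Z})$ is the real random variable whose randomness comes from $\mathbf{Z}$. *)

theory Defs
  imports "HOL-Probability.Probability"
begin

definition rv_support :: "'w measure \<Rightarrow> ('w \<Rightarrow> 'a::topological_space) \<Rightarrow> 'a set" where
  "rv_support M Z = (LEAST D. closed D \<and> \<P>(w in M. Z w \<in> D) = 1)"

text \<open>The least such set exists for random variables in a second countable space, so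
  \<^const>\<open>rv_support\<close> is not an unspecified value there.\<close>

lemma rv_support_smallest:
  fixes Z :: "'w \<Rightarrow> 'a::second_countable_topology"
  assumes "prob_space M" "Z \<in> borel_measurable M"
  shows "closed (rv_support M Z)" "\<P>(w in M. Z w \<in> rv_support M Z) = 1"
    and "closed C \<Longrightarrow> \<P>(w in M. Z w \<in> C) = 1 \<Longrightarrow> rv_support M Z \<subseteq> C"
proof -
  interpret prob_space M by fact
  let ?P = "\<lambda>D. closed D \<and> \<P>(w in M. Z w \<in> D) = 1"
  let ?S = "\<Inter>{D. ?P D}"
  have meas: "{w \<in> space M. Z w \<in> D} \<in> sets M" if "closed D" for D
    using measurable_sets[OF assms(2) borel_closed[OF that]] by (simp add: vimage_def Int_def conj_commute)
  have ae: "AE w in M. Z w \<in> D" if "?P D" for D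
    using that prob_eq_1[OF meas, of D] by auto
  obtain \<F> where \<F>: "\<F> \<subseteq> uminus ` {D. ?P D}" "countable \<F>" "\<Union>\<F> = \<Union>(uminus ` {D. ?P D})"
    by (rule Lindelof[of "uminus ` {D. ?P D}"]) auto
  have "AE w in M. \<forall>U\<in>\<F>. Z w \<notin> U"
    using \<F> ae by (subst AE_ball_countable) auto
  moreover have S: "?S = - \<Union>\<F>"
    using \<F>(3) by auto
  ultimately have "AE w in M. Z w \<in> ?S"
    by (elim AE_mp) (auto simp: S)
  moreover have cl: "closed ?S" by auto
  ultimately have P: "?P ?S"
    using prob_eq_1[OF meas, of ?S] by auto
  have eq: "rv_support M Z = ?S"
    unfolding rv_support_def using P by (intro Least_equality) auto
  show "closed (rv_support M Z)" "\<P>(w in M. Z w \<in> rv_support M Z) = 1"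
    using P unfolding eq by blast+
  show "rv_support M Z \<subseteq> C" if "closed C" "\<P>(w in M. Z w \<in> C) = 1"
    unfolding eq using that by blast
qed

definition value_at_risk :: "'w measure \<Rightarrow> real \<Rightarrow> ('w \<Rightarrow> real) \<Rightarrow> real" where
  "value_at_risk M \<alpha> Y = Inf {\<omega>. \<P>(w in M. Y w \<le> \<omega>) \<ge> \<alpha>}"

text \<open>The random variable \<open>g(Z)\<close> for a function \<open>g\<close> given only on the support \<open>D\<close> of \<open>Z\<close>.
  The event \<open>Z \<notin> D\<close> is null, so the value 0 there does not affect the distribution; it keeps
  \<open>g(Z)\<close> measurable whatever the values of the total function \<open>g\<close> outside \<open>D\<close>.\<close>

definition rv_apply :: "'a set \<Rightarrow> ('a \<Rightarrow> real) \<Rightarrow> ('w \<Rightarrow> 'a) \<Rightarrow> 'w \<Rightarrow> real" where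
  "rv_apply D g Z = (\<lambda>w. if Z w \<in> D then g (Z w) else 0)"

definition argmax_set :: "'a set \<Rightarrow> ('a \<Rightarrow> real) \<Rightarrow> 'a set" where
  "argmax_set D g = {x. is_arg_max g (\<lambda>x. x \<in> D) x}"

text \<open>The minimum of a set of reals; \<^const>\<open>Min\<close> is meaningful for finite sets only.\<close>

definition set_minimum :: "real set \<Rightarrow> real" where
  "set_minimum A = (LEAST v. v \<in> A)"

end

theory Submission
  imports Defs
begin

text \<open>The values at risk of \<open>g(Z)\<close> tend, as \<open>\<alpha> \<rightarrow> 0\<close>, to the minimum \<open>m\<close> of \<open>g\<close> on the support \<open>D\<close>:
  no \<open>\<omega> < m\<close> has \<open>P(g(Z) \<le> \<omega>) > 0\<close>, because \<open>g(Z) \<ge> m\<close> almost surely; and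
  \<open>P(g(Z) \<le> m + \<epsilon>) > 0\<close> for \<open>\<epsilon> > 0\<close>, because otherwise the closed set \<open>{z \<in> D. m + \<epsilon> \<le> g z}\<close>,
  which misses the minimizer, would already have full measure. The two objective functions therefore
  agree pointwise.\<close>

lemma set_minimum_image_eq:
  assumes "z0 \<in> D" "\<And>z. z \<in> D \<Longrightarrow> g z0 \<le> g z"
  shows "set_minimum (g ` D) = g z0"
  unfolding set_minimum_def using assms by (intro Least_equality) auto

lemma argmax_set_cong:
  assumes "\<And>x. x \<in> D \<Longrightarrow> g x = h x"
  shows "argmax_set D g = argmax_set D h"
  using assms by (auto simp: argmax_set_def is_arg_max_def)

text \<open>Cutting \<open>g\<close> off to 0 outside the closed set \<open>D\<close> gives a Borel
  function on the whole space, and \<open>rv_apply D g Z\<close> is its composition with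
  \<open>Z\<close>.\<close>

lemma rv_apply_measurable:
  fixes g :: "'a::topological_space \<Rightarrow> real"
  assumes "closed D" "continuous_on D g" "Z \<in> borel_measurable M"
  shows "rv_apply D g Z \<in> borel_measurable M"
proof -
  have "(\<lambda>z. indicator D z *\<^sub>R g z) \<in> borel_measurable borel"
    using assms by (intro borel_measurable_continuous_on_indicator borel_closed)
  from measurable_compose[OF assms(3) this] show ?thesis
    by (rule measurable_cong[THEN iffD1, rotated]) (simp add: rv_apply_def)
qed

lemma value_at_risk_tendsto_minimum:
  fixes Z :: "'w \<Rightarrow> 'a::second_countable_topology" and g :: "'a \<Rightarrow> real"
  assumes "prob_space M" and Z: "Z \<in> borel_measurable M"
    and D_def: "D = rv_support M Z"
    and cont: "continuous_on D g"
    and z0: "z0 \<in> D" and min: "\<And>z. z \<in> D \<Longrightarrow> g z0 \<le> g z"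
  shows "((\<lambda>\<alpha>. value_at_risk M \<alpha> (rv_apply D g Z)) \<longlongrightarrow> g z0) (at_right 0)"
proof -
  interpret prob_space M by fact
  define Y where "Y = rv_apply D g Z"
  note supp = rv_support_smallest[OF assms(1) Z, folded D_def]
  have [measurable]: "Z \<in> borel_measurable M" "Y \<in> borel_measurable M" "D \<in> sets borel"
    using supp(1) cont Z by (auto simp: Y_def intro: rv_apply_measurable)
  have "AE w in M. Z w \<in> D"
    using supp(2) by (subst (asm) prob_Collect_eq_1) auto
  then have Y_eq: "AE w in M. Y w = g (Z w) \<and> Z w \<in> D"
    by eventually_elim (simp add: Y_def rv_apply_def)
  have below: "\<P>(w in M. Y w \<le> \<omega>) = 0" if "\<omega> < g z0" for \<omega>
  proof -
    have "AE w in M. \<not> Y w \<le> \<omega>"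
      using Y_eq
    proof eventually_elim
      case (elim w)
      then show ?case using min[of "Z w"] that by simp
    qed
    then show ?thesis
      by (subst prob_Collect_eq_0) auto
  qed
  have above: "\<P>(w in M. Y w \<le> \<omega>) > 0" if "g z0 < \<omega>" for \<omega>
  proof (rule ccontr)
    define C where "C = {z \<in> D. \<omega> \<le> g z}"
    assume "\<not> \<P>(w in M. Y w \<le> \<omega>) > 0"
    then have "\<P>(w in M. Y w \<le> \<omega>) = 0"
      by (meson measure_nonneg not_less order_antisym)
    then have "AE w in M. \<not> Y w \<le> \<omega>"
      by (subst (asm) prob_Collect_eq_0) auto
    with Y_eq have "AE w in M. Z w \<in> C"
      by eventually_elim (auto simp: C_def)
    moreover have "closed C"
      using continuous_closed_preimage[OF cont supp(1) closed_atLeast[of \<omega>]]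
      by (simp add: C_def vimage_def Int_def)
    moreover from this have [measurable]: "C \<in> sets borel" by (rule borel_closed)
    \<comment> \<open>Minimality of the support: \<open>C\<close> is closed and has probability
      1.\<close>
    ultimately have "D \<subseteq> C"
      by (intro supp(3)) (auto simp: prob_Collect_eq_1)
    with z0 that show False by (auto simp: C_def)
  qed
  have lower: "g z0 \<le> \<omega>" if "\<alpha> > 0" "\<P>(w in M. Y w \<le> \<omega>) \<ge> \<alpha>" for \<alpha> \<omega>
    using below[of \<omega>] that by (cases "\<omega> < g z0") auto
  \<comment> \<open>The infimum is over a set that contains \<open>\<omega>\<close> and, because
    \<alpha> > 0, is bounded below by \<open>g z0\<close>; so \<open>Inf\<close> is a genuine
    infimum here.\<close>
  have bounds: "g z0 \<le> value_at_risk M \<alpha> Y \<and> value_at_risk M \<alpha> Y \<le> \<omega>"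
    if "\<alpha> > 0" "\<alpha> \<le> \<P>(w in M. Y w \<le> \<omega>)" for \<alpha> \<omega>
    unfolding value_at_risk_def using that lower[OF that(1)]
    by (auto intro!: cInf_greatest cInf_lower bdd_belowI[of _ "g z0"])
  have ev: "\<forall>\<^sub>F \<alpha> in at_right 0. g z0 \<le> value_at_risk M \<alpha> Y \<and> value_at_risk M \<alpha> Y \<le> \<omega>"
    if "g z0 < \<omega>" for \<omega>
    \<comment> \<open>The right neighbourhood of 0 is the interval up to
      \<open>\<P>(w in M. Y w \<le> \<omega>)\<close>, which \<open>above\<close> shows to be
      nonempty.\<close>
    unfolding eventually_at_right_field using above[OF that] bounds[OF _ less_imp_le] by blast
  show ?thesis
    unfolding Y_def[symmetric]
  proof (rule order_tendstoI)
    fix a assume "a < g z0"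
    \<comment> \<open>Any number above \<open>g z0\<close> would do, since only the lower bound in
      \<open>ev\<close> matters.\<close>
    with ev[of "g z0 + 1"] show "\<forall>\<^sub>F \<alpha> in at_right 0. a < value_at_risk M \<alpha> Y"
      by (auto elim: eventually_mono)
  next
    fix a assume "g z0 < a"
    \<comment> \<open>The upper bound in \<open>ev\<close> is not strict, hence the intermediate
      \<open>b\<close>.\<close>
    then obtain b where "g z0 < b" "b < a"
      using dense by blast
    with ev[of b] show "\<forall>\<^sub>F \<alpha> in at_right 0. value_at_risk M \<alpha> Y < a"
      by (auto elim: eventually_mono)
  qed
qed

text \<open>The first conjunct gives the second its meaning: \<open>Lim\<close> is the intended
  value only where a limit exists.\<close>

theorem corollary2p1:
  fixes M :: "'w measure"
    and Z :: "'w \<Rightarrow> real ^ 'dz"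
    and Dx :: "(real ^ 'dx) set"
    and Dz :: "(real ^ 'dz) set"
    and f :: "real ^ 'dx \<Rightarrow> real ^ 'dz \<Rightarrow> real"
  assumes "prob_space M"
    and "Z \<in> borel_measurable M"
    and "Dz = rv_support M Z"
    and "\<And>x. x \<in> Dx \<Longrightarrow> continuous_on Dz (f x)"
    and "\<And>x. x \<in> Dx \<Longrightarrow> \<exists>z0\<in>Dz. \<forall>z\<in>Dz. f x z0 \<le> f x z"
  shows "(\<forall>x\<in>Dx. \<exists>l. ((\<lambda>\<alpha>. value_at_risk M \<alpha> (rv_apply Dz (f x) Z)) \<longlongrightarrow> l) (at_right 0)) \<and>
    argmax_set Dx (\<lambda>x. set_minimum (f x ` Dz)) =
    argmax_set Dx (\<lambda>x. Lim (at_right 0) (\<lambda>\<alpha>. value_at_risk M \<alpha> (rv_apply Dz (f x) Z)))"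
proof -
  let ?V = "\<lambda>x \<alpha>. value_at_risk M \<alpha> (rv_apply Dz (f x) Z)"
  have lim: "(?V x \<longlongrightarrow> set_minimum (f x ` Dz)) (at_right 0)" if x: "x \<in> Dx" for x
  proof -
    obtain z0 where "z0 \<in> Dz" "\<forall>z\<in>Dz. f x z0 \<le> f x z"
      using assms(5)[OF x] by blast
    then show ?thesis
      using value_at_risk_tendsto_minimum[OF assms(1-3) assms(4)[OF x], of z0]
        set_minimum_image_eq[of z0 Dz "f x"] by simp
  qed
  then have "set_minimum (f x ` Dz) = Lim (at_right 0) (?V x)" if "x \<in> Dx" for x
    using that by (intro tendsto_Lim[symmetric]) auto
  with lim show ?thesis
    by (intro conjI argmax_set_cong) blast+
qed

end
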